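(* Let $X$ be a real finite-dimensional Banach space and let $T:X\to X$ be a polynomial diffeomorphism with an asymptotically stable, hyperbolic fixed point at $0$, such that the complexified differential $T_{\mathbb C}'(0):X_{\mathbb C}\to X_{\mathbb C}$ is diagonalizable. Let $K\subset X$ be a compact neighborhood of $0$, and let $\mathcal A_K\subset C_{\mathbb C}(K)$ be the principle algebra on $K$, i.e. the complex algebra generated by the restrictions $\phi_1|_K,\dots,\phi_n|_K$ of the principle eigenfunctions. Then the closure of $\mathcal A_K$ in the uniform norm is (a) $C_{\mathbb C}(K)$, if the constant functions are appended to $\mathcal A_K$; (b) the maximal ideal $I_0=\{f\in C_{\mathbb C}(K) : f(0)=0\}$, otherwise.
   Context: $C_{\mathbb C}(K)$ is the space of complex-valued continuous functions on $K$ with the uniform norm. $X_{\mathbb C}=\{x+iy : x,y\in X\}$ is the complexification of $X$ (so $X\subset X_{\mathbb C}$ via $x\mapsto x+i0$), and $T'_{\mathbb C}(0)$ is the complex-linear extension to $X_{\mathbb C}$ of the differential $T'(0):X\to X$. Let $n=\dim X$ and let $\{e_1,\dots,e_n\}$ be a basis of $X_{\mathbb C}$ of eigenvectors of $T'_{\mathbb C}(0)$, chosen so that each eigenvector is either real (in $X$) or occurs together with its complex conjugate ($e_{j+1}=e_j^*=x_j-iy_j$ when $e_j=x_j+iy_j$). The principle eigenfunctions are the dual basis $\phi_1,\dots,\phi_n\in X_{\mathbb C}^*$, $\phi_k(e_j)=\delta_{j,k}$; they are restricted to $K\subset X\subset X_{\mathbb C}$. "The algebra generated by" a set of functions means the set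 of all finite complex linear combinations of products of one or more of these functions (pointwise multiplication); without appending the constants it is not assumed to contain nonzero constants. *)

theory Defs
  imports "HOL-Analysis.Analysis" "HOL-Algebra.Ideal"
begin

section \<open>Complexification of a real vector space\<close>

text \<open>The element \<open>x + iy\<close> of the complexification is encoded as the pair \<open>(x, y)\<close>; addition is the
  componentwise one of the product type.\<close>

definition cscale :: "complex \<Rightarrow> 'a::real_vector \<times> 'a \<Rightarrow> 'a \<times> 'a" where
  "cscale c z = (Re c *\<^sub>R fst z - Im c *\<^sub>R snd z, Re c *\<^sub>R snd z + Im c *\<^sub>R fst z)"

global_interpretation cplx: vector_space "cscale :: complex \<Rightarrow> 'a::real_vector \<times> 'a \<Rightarrow> 'a \<times> 'a"
  by unfold_locales (auto simp: cscale_def algebra_simps)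

definition embed :: "'a::real_vector \<Rightarrow> 'a \<times> 'a" where
  "embed x = (x, 0)"

definition cconj :: "'a::real_vector \<times> 'a \<Rightarrow> 'a \<times> 'a" where
  "cconj z = (fst z, - snd z)"

definition complexify :: "('a::real_vector \<Rightarrow> 'a) \<Rightarrow> 'a \<times> 'a \<Rightarrow> 'a \<times> 'a" where
  "complexify L z = (L (fst z), L (snd z))"

lemma linear_complexify:
  assumes "linear L"
  shows "Vector_Spaces.linear cscale cscale (complexify L)"
proof -
  interpret L: linear L by fact
  show ?thesis
    by unfold_locales (auto simp: complexify_def cscale_def L.add L.diff L.scale)
qed

definition eigenpair :: "('a::real_vector \<times> 'a \<Rightarrow> 'a \<times> 'a) \<Rightarrow> complex \<Rightarrow> 'a \<times> 'a \<Rightarrow> bool" where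
  "eigenpair M c v \<longleftrightarrow> v \<noteq> 0 \<and> M v = cscale c v"

definition diagonalizable :: "('a::real_vector \<times> 'a \<Rightarrow> 'a \<times> 'a) \<Rightarrow> bool" where
  "diagonalizable M \<longleftrightarrow>
     (\<exists>B. cplx.independent B \<and> cplx.span B = UNIV \<and> (\<forall>v\<in>B. \<exists>c. eigenpair M c v))"

section \<open>Diffeomorphisms and fixed points\<close>

text \<open>Smoothness is taken to be \<open>C\<^sup>1\<close>. For a polynomial map this is no weaker than \<open>C\<^sup>\<infinity>\<close>, by the
  inverse function theorem. The inverse is not required to be polynomial.\<close>

definition C1_map :: "('a::real_normed_vector \<Rightarrow> 'b::real_normed_vector) \<Rightarrow> bool" where
  "C1_map f \<longleftrightarrow> (\<exists>f' :: 'a \<Rightarrow> 'a \<Rightarrow>\<^sub>L 'b.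
     (\<forall>x. (f has_derivative blinfun_apply (f' x)) (at x)) \<and> continuous_on UNIV f')"

definition diffeomorphism :: "('a::real_normed_vector \<Rightarrow> 'b::real_normed_vector) \<Rightarrow> bool" where
  "diffeomorphism f \<longleftrightarrow> bij f \<and> C1_map f \<and> C1_map (inv_into UNIV f)"

text \<open>Lyapunov stability together with local attraction.\<close>

definition asymptotically_stable :: "('a::real_normed_vector \<Rightarrow> 'a) \<Rightarrow> 'a \<Rightarrow> bool" where
  "asymptotically_stable T p \<longleftrightarrow>
     (\<forall>\<epsilon>>0. \<exists>\<delta>>0. \<forall>x. dist x p < \<delta> \<longrightarrow> (\<forall>k. dist ((T ^^ k) x) p < \<epsilon>)) \<and>
     (\<exists>\<delta>>0. \<forall>x. dist x p < \<delta> \<longrightarrow> (\<lambda>k. (T ^^ k) x) \<longlonglongrightarrow> p)"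

definition hyperbolic :: "('a::real_normed_vector \<Rightarrow> 'a) \<Rightarrow> 'a \<Rightarrow> bool" where
  "hyperbolic T p \<longleftrightarrow>
     (\<forall>c v. eigenpair (complexify (frechet_derivative T (at p))) c v \<longrightarrow> cmod c \<noteq> 1)"

section \<open>Principle eigenfunctions\<close>

text \<open>A basis \<open>e 1, \<dots>, e n\<close> of eigenvectors in which each vector is real or is adjacent to its
  complex conjugate.\<close>

definition conj_eigenbasis ::
    "('a::real_vector \<times> 'a \<Rightarrow> 'a \<times> 'a) \<Rightarrow> nat \<Rightarrow> (nat \<Rightarrow> 'a \<times> 'a) \<Rightarrow> bool" where
  "conj_eigenbasis M n e \<longleftrightarrow>
     inj_on e {1..n} \<and> cplx.independent (e ` {1..n}) \<and> cplx.span (e ` {1..n}) = UNIV \<and>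
     (\<forall>j\<in>{1..n}. \<exists>c. eigenpair M c (e j)) \<and>
     (\<forall>j\<in>{1..n}. e j \<in> range embed \<or>
                 (j < n \<and> e (j + 1) = cconj (e j)) \<or>
                 (1 < j \<and> e j = cconj (e (j - 1))))"

text \<open>Functionals on the finite-dimensional complexification are automatically continuous, so only
  linearity is required.\<close>

definition principle_eigenfunctions ::
    "nat \<Rightarrow> (nat \<Rightarrow> 'a::real_vector \<times> 'a) \<Rightarrow> (nat \<Rightarrow> 'a \<times> 'a \<Rightarrow> complex) \<Rightarrow> bool" where
  "principle_eigenfunctions n e \<phi> \<longleftrightarrow>
     (\<forall>k\<in>{1..n}. Vector_Spaces.linear cscale (*) (\<phi> k) \<and>
        (\<forall>j\<in>{1..n}. \<phi> k (e j) = (if j = k then 1 else 0)))"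

section \<open>Continuous functions on a compact set\<close>

text \<open>Functions on \<open>K\<close> are represented by functions on the whole type that are \<open>undefined\<close> outside
  \<open>K\<close>, as in \<^const>\<open>cfunspace\<close>, whose metric is the supremum metric.\<close>

definition CK :: "'a::topological_space set \<Rightarrow> ('a \<Rightarrow> complex) metric" where
  "CK K = cfunspace (top_of_set K) euclidean_metric"

definition CK_ring :: "'a::topological_space set \<Rightarrow> ('a \<Rightarrow> complex) ring" where
  "CK_ring K = \<lparr>carrier = mspace (CK K),
     monoid.mult = (\<lambda>f g. restrict (\<lambda>x. f x * g x) K), one = restrict (\<lambda>x. 1) K,
     zero = restrict (\<lambda>x. 0) K, add = (\<lambda>f g. restrict (\<lambda>x. f x + g x) K)\<rparr>"

definition ideal_at_zero :: "'a::real_normed_vector set \<Rightarrow> ('a \<Rightarrow> complex) set" where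
  "ideal_at_zero K = {f \<in> mspace (CK K). f 0 = 0}"

definition uniform_closure ::
    "'a::topological_space set \<Rightarrow> ('a \<Rightarrow> complex) set \<Rightarrow> ('a \<Rightarrow> complex) set" where
  "uniform_closure K A = mtopology_of (CK K) closure_of A"

definition constants :: "'a set \<Rightarrow> ('a \<Rightarrow> complex) set" where
  "constants K = range (\<lambda>c. restrict (\<lambda>x. c) K)"

text \<open>Products are over nonempty lists, so the algebra need not contain the constants.\<close>

definition products :: "'a set \<Rightarrow> ('a \<Rightarrow> complex) set \<Rightarrow> ('a \<Rightarrow> complex) set" where
  "products K G = {restrict (\<lambda>x. \<Prod>f\<leftarrow>fs. f x) K | fs. fs \<noteq> [] \<and> set fs \<subseteq> G}"

definition algebra_generated :: "'a set \<Rightarrow> ('a \<Rightarrow> complex) set \<Rightarrow> ('a \<Rightarrow> complex) set" where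
  "algebra_generated K G =
     {restrict (\<lambda>x. \<Sum>p\<in>S. c p * p x) K | S c. finite S \<and> S \<subseteq> products K G}"

definition principle_algebra ::
    "'a::real_vector set \<Rightarrow> nat \<Rightarrow> (nat \<Rightarrow> 'a \<times> 'a \<Rightarrow> complex) \<Rightarrow> ('a \<Rightarrow> complex) set" where
  "principle_algebra K n \<phi> =
     algebra_generated K ((\<lambda>k. restrict (\<lambda>x. \<phi> k (embed x)) K) ` {1..n})"

end

theory Submission
  imports Defs
begin

text \<open>The eigenfunctions are a basis of the complex dual, so they separate the points of \<open>X\<close>.
  Complex conjugation permutes the eigenbasis, hence \<open>x \<mapsto> cnj (\<phi>\<^sub>k x)\<close> is again an
  eigenfunction on \<open>X\<close>, and the Stone--Weierstrass theorem applies once the constants are adjoined.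
  Adjoining them only adds scalars: every element of the larger algebra is \<open>a + c\<close> with
  \<open>a(0) = 0\<close>. If it approximates a function vanishing at \<open>0\<close> up to \<open>r\<close>, then \<open>\<bar>c\<bar> < r\<close>, so \<open>a\<close>
  approximates it up to \<open>2r\<close>. The only analytic input from finite dimension is the continuity
  of linear functionals.\<close>

section \<open>Linear maps on normed spaces with a finite spanning set\<close>

text \<open>Compactness of the unit \<open>\<ell>\<^sup>1\<close>-sphere of coefficients, taken in the product topology since
  the type is not in \<^class>\<open>euclidean_space\<close>.\<close>

lemma sum_abs_coeff_le_norm:
  fixes B :: "'a::real_normed_vector set"
  assumes "finite B" "independent B"
  obtains c where "c > 0" "\<And>a. c * (\<Sum>b\<in>B. \<bar>a b\<bar>) \<le> norm (\<Sum>b\<in>B. a b *\<^sub>R b)"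
proof -
  \<comment> \<open>Coefficients off \<open>B\<close> are pinned to \<open>0\<close>, which makes
    \<open>P\<close> a product of compact sets over the whole type; Tychonoff's theorem then
    applies.\<close>
  define P :: "('a \<Rightarrow> real) set" where "P = PiE UNIV (\<lambda>b. if b \<in> B then {-1..1} else {0})"
  define S where "S = P \<inter> {a. (\<Sum>b\<in>B. \<bar>a b\<bar>) = 1}"
  have "compactin (product_topology (\<lambda>_. euclidean) UNIV) P"
    unfolding P_def compactin_PiE by auto
  then have "compact P"
    by (simp add: euclidean_product_topology)
  moreover have "closed {a. (\<Sum>b\<in>B. \<bar>a b :: real\<bar>) = 1}"
    by (intro closed_Collect_eq continuous_intros continuous_on_product_coordinates)
  ultimately have "compact S"
    unfolding S_def by (rule compact_Int_closed)
  have bound: "\<exists>c>0. \<forall>a\<in>S. c \<le> norm (\<Sum>b\<in>B. a b *\<^sub>R b)"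
  proof (cases "S = {}")
    \<comment> \<open>The sphere is empty exactly when \<open>B\<close> is, and then any positive
      constant serves.\<close>
    case True
    then show ?thesis by (auto intro: exI[of _ 1])
  next
    case False
    have "continuous_on S (\<lambda>a. norm (\<Sum>b\<in>B. a b *\<^sub>R b))"
      by (rule continuous_on_subset[of UNIV])
         (intro continuous_intros continuous_on_product_coordinates, simp)
    then obtain m where m: "m \<in> S"
        "\<And>a. a \<in> S \<Longrightarrow> norm (\<Sum>b\<in>B. m b *\<^sub>R b) \<le> norm (\<Sum>b\<in>B. a b *\<^sub>R b)"
      using continuous_attains_inf[OF \<open>compact S\<close> False] by blast
    \<comment> \<open>Independence makes the minimum positive: a vanishing combination would force
      all coefficients of \<open>m\<close> on \<open>B\<close> to vanish, while their absolute
      values sum to \<open>1\<close>.\<close>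
    have "(\<Sum>b\<in>B. m b *\<^sub>R b) \<noteq> 0"
    proof
      assume "(\<Sum>b\<in>B. m b *\<^sub>R b) = 0"
      then have "m b = 0" if "b \<in> B" for b
        using assms that independent_explicit_finite_subsets by blast
      then show False using m(1) by (simp add: S_def)
    qed
    with m(2) show ?thesis by (intro exI[of _ "norm (\<Sum>b\<in>B. m b *\<^sub>R b)"]) auto
  qed
  then obtain c where c: "c > 0" "\<And>a. a \<in> S \<Longrightarrow> c \<le> norm (\<Sum>b\<in>B. a b *\<^sub>R b)"
    by blast
  have "c * (\<Sum>b\<in>B. \<bar>a b\<bar>) \<le> norm (\<Sum>b\<in>B. a b *\<^sub>R b)" for a
  proof -
    define s where "s = (\<Sum>b\<in>B. \<bar>a b\<bar>)"
    show ?thesis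
    proof (cases "s = 0")
      case True
      then show ?thesis by (simp add: s_def)
    next
      case False
      then have "s > 0" unfolding s_def by (simp add: sum_nonneg order.not_eq_order_implies_strict)
      \<comment> \<open>Rescaling moves \<open>a\<close> onto the sphere; the value \<open>0\<close>
        off \<open>B\<close> is what membership in \<open>P\<close> demands.\<close>
      define a' where "a' b = (if b \<in> B then a b / s else 0)" for b
      have le: "\<bar>a b\<bar> \<le> s" if "b \<in> B" for b
        unfolding s_def using that assms(1) by (intro member_le_sum) auto
      have "a' \<in> P"
        using le \<open>s > 0\<close> by (fastforce simp: P_def a'_def field_simps abs_le_iff)
      moreover have "(\<Sum>b\<in>B. \<bar>a' b\<bar>) = 1"
        using \<open>s > 0\<close> by (simp add: a'_def abs_divide flip: sum_divide_distrib s_def)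
      ultimately have "a' \<in> S" by (simp add: S_def)
      have "(\<Sum>b\<in>B. a' b *\<^sub>R b) = (1 / s) *\<^sub>R (\<Sum>b\<in>B. a b *\<^sub>R b)"
        by (simp add: a'_def scaleR_sum_right)
      with c(2)[OF \<open>a' \<in> S\<close>] \<open>s > 0\<close> have "c * s \<le> norm (\<Sum>b\<in>B. a b *\<^sub>R b)"
        by (simp add: field_simps)
      then show ?thesis by (simp add: s_def)
    qed
  qed
  with c(1) show thesis by (rule that)
qed

text \<open>Once the spanning set is thinned out to a basis, \<open>norm (f x)\<close> is at most a
  constant times the sum of the absolute coefficients of \<open>x\<close>, and that sum is
  controlled by \<open>norm x\<close>.\<close>

lemma linear_bounded_linear_finite_span:
  fixes f :: "'a::real_normed_vector \<Rightarrow> 'b::real_normed_vector"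
  assumes "finite B" "span B = (UNIV :: 'a set)" "linear f"
  shows "bounded_linear f"
proof -
  obtain C where C: "C \<subseteq> B" "independent C" "B \<subseteq> span C"
    using maximal_independent_subset by metis
  have "finite C" using C(1) assms(1) by (rule finite_subset)
  have "span C = UNIV"
    using span_mono[OF C(3)] assms(2) by (simp add: span_span top.extremum_unique)
  obtain c where c: "c > 0" "\<And>a. c * (\<Sum>b\<in>C. \<bar>a b\<bar>) \<le> norm (\<Sum>b\<in>C. a b *\<^sub>R b)"
    using sum_abs_coeff_le_norm[OF \<open>finite C\<close> C(2)] by blast
  define M where "M = (\<Sum>b\<in>C. norm (f b))"
  have "norm (f x) \<le> norm x * (M / c)" for x
  proof -
    have "x \<in> span C" using \<open>span C = UNIV\<close> by simp
    then obtain a where a: "x = (\<Sum>b\<in>C. a b *\<^sub>R b)"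
      using \<open>finite C\<close> by (auto simp: span_finite)
    have "norm (f x) = norm (\<Sum>b\<in>C. a b *\<^sub>R f b)"
      using assms(3) by (simp add: a linear_sum linear_scale)
    also have "\<dots> \<le> (\<Sum>b\<in>C. \<bar>a b\<bar> * norm (f b))"
      by (rule order_trans[OF norm_sum]) simp
    also have "\<dots> \<le> (\<Sum>b\<in>C. \<bar>a b\<bar> * M)"
      unfolding M_def using \<open>finite C\<close>
      by (intro sum_mono mult_left_mono member_le_sum) auto
    also have "\<dots> = (c * (\<Sum>b\<in>C. \<bar>a b\<bar>)) * (M / c)"
      using c(1) by (simp add: sum_distrib_right)
    also have "\<dots> \<le> norm x * (M / c)"
      unfolding a using c by (intro mult_right_mono) (auto simp: M_def sum_nonneg)
    finally show ?thesis .
  qed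
  with assms(3) show ?thesis
    by (intro bounded_linear_intro[of f "M / c"]) (auto simp: linear_add linear_scale)
qed

lemma linear_continuous_on_finite_span:
  fixes f :: "'a::real_normed_vector \<Rightarrow> 'b::real_normed_vector"
  assumes "finite B" "span B = (UNIV :: 'a set)" "linear f"
  shows "continuous_on S f"
  by (rule linear_continuous_on[OF linear_bounded_linear_finite_span[OF assms]])

section \<open>Uniform approximation on a compact set\<close>

text \<open>The functions in \<open>cfunspace\<close> are bounded by definition; on a compact set
  continuity already implies this.\<close>

lemma mspace_CK:
  assumes "compact K"
  shows "mspace (CK K) = {f. f \<in> extensional K \<and> continuous_on K f}"
proof -
  have "compactin (top_of_set K) (topspace (top_of_set K))"
    using assms by (simp add: compactin_subtopology)
  then show ?thesis
    unfolding CK_def by (subst compactin_mspace_cfunspace) auto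
qed

lemma restrict_mem_mspace_CK:
  assumes "compact K"
  shows "restrict f K \<in> mspace (CK K) \<longleftrightarrow> continuous_on K f"
  by (simp add: mspace_CK[OF assms] cong: continuous_on_cong)

text \<open>Translates the topological closure into an epsilon criterion. Non-strict bounds on the
  supremum distance can be read off pointwise when \<open>K\<close> is nonempty, so closed balls
  come first.\<close>

lemma mem_uniform_closure_iff:
  assumes "compact K" "K \<noteq> {}" "A \<subseteq> mspace (CK K)"
  shows "f \<in> uniform_closure K A \<longleftrightarrow>
    f \<in> mspace (CK K) \<and> (\<forall>r>0. \<exists>g\<in>A. \<forall>x\<in>K. cmod (f x - g x) < r)"
proof -
  interpret Metric_space "mspace (CK K)" "mdist (CK K)"
    by (rule Metric_space_mspace_mdist)
  have le: "mdist (CK K) f g \<le> a \<longleftrightarrow> (\<forall>x\<in>K. cmod (f x - g x) \<le> a)"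
    if "f \<in> mspace (CK K)" "g \<in> mspace (CK K)" for f g a
    using cfunspace_mdist_le[of f "top_of_set K" euclidean_metric g a] that assms(2)
    by (simp add: CK_def dist_norm)
  have "f \<in> uniform_closure K A \<longleftrightarrow>
    f \<in> mspace (CK K) \<and> (\<forall>r>0. \<exists>g\<in>A. mdist (CK K) f g \<le> r)"
    using assms(3)
    by (auto simp: uniform_closure_def mtopology_of_def metric_closure_of_alt in_mcball)
      (meson in_mono)
  also have "\<dots> \<longleftrightarrow> f \<in> mspace (CK K) \<and> (\<forall>r>0. \<exists>g\<in>A. \<forall>x\<in>K. cmod (f x - g x) \<le> r)"
    using assms(3) by (auto simp: le subset_iff)
  \<comment> \<open>Since \<open>r\<close> is arbitrary, approximating within some number strictly
    between \<open>0\<close> and \<open>r\<close> turns the non-strict bound into a strict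
    one.\<close>
  also have "\<dots> \<longleftrightarrow> f \<in> mspace (CK K) \<and> (\<forall>r>0. \<exists>g\<in>A. \<forall>x\<in>K. cmod (f x - g x) < r)"
    by (meson dense le_less_trans less_imp_le)
  finally show ?thesis .
qed

section \<open>Closure properties and induction for generated algebras\<close>

lemma restrict_generator_in_algebra:
  assumes "g \<in> G"
  shows "restrict g K \<in> algebra_generated K G"
proof -
  have "restrict g K \<in> products K G"
    unfolding products_def using assms by (intro CollectI exI[of _ "[g]"]) auto
  moreover have "restrict g K = restrict (\<lambda>x. \<Sum>p\<in>{restrict g K}. 1 * p x) K"
    by auto
  ultimately show ?thesis
    unfolding algebra_generated_def
    by (intro CollectI exI[of _ "{restrict g K}"] exI[of _ "\<lambda>_. 1"]) auto
qed

text \<open>The definition sums over a set, with one coefficient for each product. In an indexed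
  family the same product may occur repeatedly, so the coefficients over each fibre of
  \<open>p\<close> are added up.\<close>

lemma sum_products_in_algebra:
  assumes "finite I" "\<And>i. i \<in> I \<Longrightarrow> p i \<in> products K G"
  shows "restrict (\<lambda>x. \<Sum>i\<in>I. c i * p i x) K \<in> algebra_generated K G"
proof -
  have "(\<Sum>i\<in>I. c i * p i x) = (\<Sum>q\<in>p ` I. (\<Sum>i\<in>{i\<in>I. p i = q}. c i) * q x)" for x
  proof -
    have "(\<Sum>i\<in>I. c i * p i x) = (\<Sum>q\<in>p ` I. \<Sum>i\<in>{i\<in>I. p i = q}. c i * p i x)"
      by (rule sum.image_gen[OF assms(1)])
    also have "\<dots> = (\<Sum>q\<in>p ` I. (\<Sum>i\<in>{i\<in>I. p i = q}. c i) * q x)"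
      by (intro sum.cong refl) (simp add: sum_distrib_right)
    finally show ?thesis .
  qed
  moreover have "finite (p ` I)" "p ` I \<subseteq> products K G"
    using assms by auto
  ultimately show ?thesis
    unfolding algebra_generated_def
    by (intro CollectI exI[of _ "p ` I"] exI[of _ "\<lambda>q. \<Sum>i\<in>{i\<in>I. p i = q}. c i"]) auto
qed

lemma algebra_generatedE:
  assumes "f \<in> algebra_generated K G"
  obtains S c where "finite S" "S \<subseteq> products K G" "f = restrict (\<lambda>x. \<Sum>p\<in>S. c p * p x) K"
  using assms unfolding algebra_generated_def by blast

lemma algebra_generated_scale:
  assumes "restrict f K \<in> algebra_generated K G"
  shows "restrict (\<lambda>x. a * f x) K \<in> algebra_generated K G"
proof -
  obtain S c where S: "finite S" "S \<subseteq> products K G"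
    and f: "restrict f K = restrict (\<lambda>x. \<Sum>p\<in>S. c p * p x) K"
    using assms by (rule algebra_generatedE)
  have "restrict (\<lambda>x. a * f x) K = restrict (\<lambda>x. \<Sum>p\<in>S. (a * c p) * p x) K"
  proof (rule restrict_ext)
    fix x assume "x \<in> K"
    then show "a * f x = (\<Sum>p\<in>S. (a * c p) * p x)"
      using fun_cong[OF f, of x] by (simp add: sum_distrib_left mult.assoc)
  qed
  also have "\<dots> \<in> algebra_generated K G"
    using S by (intro sum_products_in_algebra) auto
  finally show ?thesis .
qed

lemma algebra_generated_add:
  assumes "restrict f K \<in> algebra_generated K G" "restrict g K \<in> algebra_generated K G"
  shows "restrict (\<lambda>x. f x + g x) K \<in> algebra_generated K G"
proof -
  obtain S c where S: "finite S" "S \<subseteq> products K G"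
    and f: "restrict f K = restrict (\<lambda>x. \<Sum>p\<in>S. c p * p x) K"
    using assms(1) by (rule algebra_generatedE)
  obtain S' c' where S': "finite S'" "S' \<subseteq> products K G"
    and g: "restrict g K = restrict (\<lambda>x. \<Sum>p\<in>S'. c' p * p x) K"
    using assms(2) by (rule algebra_generatedE)
  \<comment> \<open>The disjoint sum \<open>S <+> S'\<close> keeps both coefficients of a product
    that lies in \<open>S\<close> and in \<open>S'\<close>.\<close>
  have "restrict (\<lambda>x. f x + g x) K =
      restrict (\<lambda>x. \<Sum>i\<in>S <+> S'. case_sum c c' i * case_sum id id i x) K"
  proof (rule restrict_ext)
    fix x assume "x \<in> K"
    then show "f x + g x = (\<Sum>i\<in>S <+> S'. case_sum c c' i * case_sum id id i x)"
      using fun_cong[OF f, of x] fun_cong[OF g, of x] S(1) S'(1) by (simp add: sum.Plus)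
  qed
  also have "\<dots> \<in> algebra_generated K G"
    using S S' by (intro sum_products_in_algebra) (auto split: sum.splits)
  finally show ?thesis .
qed

lemma products_mult:
  assumes "p \<in> products K G" "q \<in> products K G"
  shows "restrict (\<lambda>x. p x * q x) K \<in> products K G"
proof -
  obtain fs gs where fs: "fs \<noteq> []" "set fs \<subseteq> G" "p = restrict (\<lambda>x. \<Prod>f\<leftarrow>fs. f x) K"
    and gs: "set gs \<subseteq> G" "q = restrict (\<lambda>x. \<Prod>f\<leftarrow>gs. f x) K"
    using assms unfolding products_def by blast
  have "restrict (\<lambda>x. p x * q x) K = restrict (\<lambda>x. \<Prod>f\<leftarrow>fs @ gs. f x) K"
    by (auto simp: fs(3) gs(2))
  then show ?thesis
    unfolding products_def using fs(1,2) gs(1) by (intro CollectI exI[of _ "fs @ gs"]) auto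
qed

lemma algebra_generated_mult:
  assumes "restrict f K \<in> algebra_generated K G" "restrict g K \<in> algebra_generated K G"
  shows "restrict (\<lambda>x. f x * g x) K \<in> algebra_generated K G"
proof -
  obtain S c where S: "finite S" "S \<subseteq> products K G"
    and f: "restrict f K = restrict (\<lambda>x. \<Sum>p\<in>S. c p * p x) K"
    using assms(1) by (rule algebra_generatedE)
  obtain S' c' where S': "finite S'" "S' \<subseteq> products K G"
    and g: "restrict g K = restrict (\<lambda>x. \<Sum>p\<in>S'. c' p * p x) K"
    using assms(2) by (rule algebra_generatedE)
  \<comment> \<open>Distinct pairs may give the same product, so the sum is indexed by pairs rather
    than by products.\<close>
  have "restrict (\<lambda>x. f x * g x) K =
      restrict (\<lambda>x. \<Sum>i\<in>S \<times> S'. (c (fst i) * c' (snd i)) * restrict (\<lambda>x. fst i x * snd i x) K x) K"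
  proof (rule restrict_ext)
    fix x assume "x \<in> K"
    then show "f x * g x =
        (\<Sum>i\<in>S \<times> S'. (c (fst i) * c' (snd i)) * restrict (\<lambda>x. fst i x * snd i x) K x)"
      using fun_cong[OF f, of x] fun_cong[OF g, of x]
      by (simp add: sum_product sum.cartesian_product case_prod_unfold mult.assoc mult.left_commute)
  qed
  also have "\<dots> \<in> algebra_generated K G"
    using S S' by (intro sum_products_in_algebra products_mult) auto
  finally show ?thesis .
qed

lemma algebra_generated_zero: "restrict (\<lambda>x. 0) K \<in> algebra_generated K G"
  using sum_products_in_algebra[of "{}"] by simp

text \<open>The property is stated for restrictions so that the cases may speak of arbitrary
  representatives of functions on \<open>K\<close>. The case \<open>zero\<close> is the empty sum,
  which is present even when \<open>G\<close> is empty.\<close>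

lemma algebra_generated_induct [consumes 1, case_names zero generator scale add mult]:
  assumes "f \<in> algebra_generated K G"
    and zero: "P (restrict (\<lambda>x. 0) K)"
    and gen: "\<And>g. g \<in> G \<Longrightarrow> P (restrict g K)"
    and scale: "\<And>a f. P (restrict f K) \<Longrightarrow> P (restrict (\<lambda>x. a * f x) K)"
    and add: "\<And>f g. P (restrict f K) \<Longrightarrow> P (restrict g K) \<Longrightarrow> P (restrict (\<lambda>x. f x + g x) K)"
    and mult: "\<And>f g. P (restrict f K) \<Longrightarrow> P (restrict g K) \<Longrightarrow> P (restrict (\<lambda>x. f x * g x) K)"
  shows "P f"
proof -
  have prods: "P (restrict (\<lambda>x. \<Prod>f\<leftarrow>fs. f x) K)" if "fs \<noteq> []" "set fs \<subseteq> G" for fs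
    using that
  proof (induction fs rule: list_nonempty_induct)
    case (single g)
    then show ?case using gen[of g] by (simp del: restrict_apply)
  next
    case (cons g gs)
    then have "P (restrict g K)" "P (restrict (\<lambda>x. \<Prod>f\<leftarrow>gs. f x) K)"
      using gen by (simp_all del: restrict_apply)
    from mult[OF this] show ?case by (simp del: restrict_apply)
  qed
  obtain S c where S: "finite S" "S \<subseteq> products K G" "f = restrict (\<lambda>x. \<Sum>p\<in>S. c p * p x) K"
    using assms(1) by (rule algebra_generatedE)
  have "P (restrict (\<lambda>x. \<Sum>p\<in>S. c p * p x) K)"
    using S(1,2)
  proof (induction S)
    case empty
    then show ?case using zero by (simp del: restrict_apply)
  next
    case (insert p S)
    have "P (restrict p K)"
      using insert.prems prods by (auto simp: products_def)
    moreover have "P (restrict (\<lambda>x. \<Sum>p\<in>S. c p * p x) K)"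
      using insert by blast
    ultimately have "P (restrict (\<lambda>x. c p * p x + (\<Sum>p\<in>S. c p * p x)) K)"
      by (intro add scale)
    then show ?case
      using insert.hyps by (simp del: restrict_apply)
  qed
  then show ?thesis by (simp add: S(3))
qed

section \<open>Complex Stone-Weierstrass theorem\<close>

text \<open>Reduction to the real theorem: a separating \<open>g\<close> whose conjugate also lies
  in the algebra contributes \<open>Re g\<close> and \<open>Im g\<close>, and one of these separates
  the two points. The real and imaginary parts of \<open>f\<close> are then approximated
  separately.\<close>

lemma Stone_Weierstrass_algebra_generated:
  fixes K :: "'a::t2_space set"
  assumes "compact K" and const: "constants K \<subseteq> algebra_generated K G"
    and sep: "\<And>x y. x \<in> K \<Longrightarrow> y \<in> K \<Longrightarrow> x \<noteq> y \<Longrightarrow>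
      \<exists>g. continuous_on K g \<and> g x \<noteq> g y \<and> restrict g K \<in> algebra_generated K G \<and>
          restrict (\<lambda>x. cnj (g x)) K \<in> algebra_generated K G"
    and f: "continuous_on K f" and "r > 0"
  shows "\<exists>h\<in>algebra_generated K G. \<forall>x\<in>K. cmod (f x - h x) < r"
proof -
  let ?A = "algebra_generated K G"
  \<comment> \<open>The real functions that belong to the complex algebra; they form the function
    ring of the real theorem.\<close>
  define R where
    "R = {g. continuous_on K g \<and> restrict (\<lambda>x. complex_of_real (g x)) K \<in> ?A}"
  interpret function_ring_on R K
  proof
    show "compact K" by fact
    show "continuous_on K g" if "g \<in> R" for g
      using that by (simp add: R_def)
    show "(\<lambda>x. g x + h x) \<in> R" if "g \<in> R" "h \<in> R" for g h
      using that algebra_generated_add[of "\<lambda>x. complex_of_real (g x)" K G "\<lambda>x. complex_of_real (h x)"]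
      by (simp add: R_def continuous_on_add)
    show "(\<lambda>x. g x * h x) \<in> R" if "g \<in> R" "h \<in> R" for g h
      using that algebra_generated_mult[of "\<lambda>x. complex_of_real (g x)" K G "\<lambda>x. complex_of_real (h x)"]
      by (simp add: R_def continuous_on_mult)
    show "(\<lambda>_. c) \<in> R" for c
      using const by (auto simp: R_def constants_def)
    show "\<exists>g\<in>R. g x \<noteq> g y" if "x \<in> K" "y \<in> K" "x \<noteq> y" for x y
    proof -
      obtain g where g: "continuous_on K g" "g x \<noteq> g y" "restrict g K \<in> ?A"
          "restrict (\<lambda>x. cnj (g x)) K \<in> ?A"
        using sep \<open>x \<in> K\<close> \<open>y \<in> K\<close> \<open>x \<noteq> y\<close> by blast
      have "restrict (\<lambda>x. (1/2) * (g x + cnj (g x))) K \<in> ?A"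
        by (intro algebra_generated_scale algebra_generated_add g)
      then have Re: "(\<lambda>x. Re (g x)) \<in> R"
        using g(1) by (simp add: R_def complex_add_cnj continuous_on_Re)
      \<comment> \<open>The difference is written as a sum with factor \<open>-1\<close>, in the
        shape that the closure rules for sums and scalar multiples match.\<close>
      have "restrict (\<lambda>x. (-\<i>/2) * (g x + (-1) * cnj (g x))) K \<in> ?A"
        by (intro algebra_generated_scale algebra_generated_add g)
      moreover have "(-\<i>/2) * (z + (-1) * cnj z) = complex_of_real (Im z)" for z
        by (simp add: complex_eq_iff)
      ultimately have Im: "(\<lambda>x. Im (g x)) \<in> R"
        using g(1) by (simp add: R_def continuous_on_Im)
      from g(2) have "Re (g x) \<noteq> Re (g y) \<or> Im (g x) \<noteq> Im (g y)"
        by (simp add: complex_eq_iff)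
      then show ?thesis
        using bexI[OF _ Re] bexI[OF _ Im] by (elim disjE)
    qed
  qed
  obtain u where u: "u \<in> R" "\<And>x. x \<in> K \<Longrightarrow> \<bar>Re (f x) - u x\<bar> < r / 2"
    using Stone_Weierstrass_basic[OF continuous_on_Re[OF f] half_gt_zero[OF \<open>r > 0\<close>]] by blast
  obtain v where v: "v \<in> R" "\<And>x. x \<in> K \<Longrightarrow> \<bar>Im (f x) - v x\<bar> < r / 2"
    using Stone_Weierstrass_basic[OF continuous_on_Im[OF f] half_gt_zero[OF \<open>r > 0\<close>]] by blast
  let ?h = "restrict (\<lambda>x. of_real (u x) + \<i> * of_real (v x)) K"
  have "?h \<in> ?A"
    using u(1) v(1) by (intro algebra_generated_add algebra_generated_scale) (auto simp: R_def)
  moreover have "cmod (f x - ?h x) < r" if "x \<in> K" for x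
  proof -
    have "cmod (f x - ?h x) \<le> \<bar>Re (f x) - u x\<bar> + \<bar>Im (f x) - v x\<bar>"
      using cmod_le[of "f x - ?h x"] that by simp
    then show ?thesis using u(2)[OF that] v(2)[OF that] by linarith
  qed
  ultimately show ?thesis by blast
qed

section \<open>Adjoining the constants\<close>

lemma constants_in_algebra: "constants K \<subseteq> algebra_generated K (A \<union> constants K)"
proof
  fix f assume "f \<in> constants K"
  then have "restrict f K \<in> algebra_generated K (A \<union> constants K)" "restrict f K = f"
    by (auto intro: restrict_generator_in_algebra simp: constants_def)
  then show "f \<in> algebra_generated K (A \<union> constants K)" by simp
qed

text \<open>The functions \<open>a + c\<close> are closed under all the operations. For products,
  \<open>(a + c) * (b + d)\<close> has constant part \<open>c * d\<close>, and the rest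
  \<open>a * b + (d * a + c * b)\<close> stays in the algebra without constants.\<close>

lemma algebra_generated_constants_decomp:
  assumes "f \<in> algebra_generated K (algebra_generated K G \<union> constants K)"
  shows "\<exists>a c. restrict a K \<in> algebra_generated K G \<and> f = restrict (\<lambda>x. a x + c) K"
  using assms
proof (induction rule: algebra_generated_induct)
  case zero
  show ?case
    by (intro exI[of _ "\<lambda>_. 0"] exI[of _ 0]) (simp add: algebra_generated_zero del: restrict_apply)
next
  case (generator g)
  then show ?case
  proof
    assume "g \<in> algebra_generated K G"
    moreover from this have "restrict g K = g"
      by (auto elim: algebra_generatedE)
    ultimately show ?thesis
      by (intro exI[of _ g] exI[of _ 0]) simp
  next
    assume "g \<in> constants K"
    then obtain c where "g = restrict (\<lambda>_. c) K" by (auto simp: constants_def)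
    then have "restrict g K = restrict (\<lambda>x. 0 + c) K" by auto
    with algebra_generated_zero show ?thesis
      by (intro exI[of _ "\<lambda>_. 0"] exI[of _ c] conjI)
  qed
next
  case (scale k f)
  then obtain a c where a: "restrict a K \<in> algebra_generated K G"
      "restrict f K = restrict (\<lambda>x. a x + c) K"
    by blast
  have "restrict (\<lambda>x. k * f x) K = restrict (\<lambda>x. k * a x + k * c) K"
  proof (rule restrict_ext)
    fix x assume "x \<in> K"
    then show "k * f x = k * a x + k * c"
      using fun_cong[OF a(2), of x] by (simp add: distrib_left)
  qed
  with algebra_generated_scale[OF a(1)] show ?case
    by (intro exI[of _ "\<lambda>x. k * a x"] exI[of _ "k * c"] conjI)
next
  case (add f g)
  then obtain a c b d where a: "restrict a K \<in> algebra_generated K G"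
      "restrict f K = restrict (\<lambda>x. a x + c) K"
    and b: "restrict b K \<in> algebra_generated K G"
      "restrict g K = restrict (\<lambda>x. b x + d) K"
    by blast
  have "restrict (\<lambda>x. f x + g x) K = restrict (\<lambda>x. (a x + b x) + (c + d)) K"
  proof (rule restrict_ext)
    fix x assume "x \<in> K"
    then show "f x + g x = (a x + b x) + (c + d)"
      using fun_cong[OF a(2), of x] fun_cong[OF b(2), of x] by simp
  qed
  with algebra_generated_add[OF a(1) b(1)] show ?case
    by (intro exI[of _ "\<lambda>x. a x + b x"] exI[of _ "c + d"] conjI)
next
  case (mult f g)
  then obtain a c b d where a: "restrict a K \<in> algebra_generated K G"
      "restrict f K = restrict (\<lambda>x. a x + c) K"
    and b: "restrict b K \<in> algebra_generated K G"
      "restrict g K = restrict (\<lambda>x. b x + d) K"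
    by blast
  have "restrict (\<lambda>x. f x * g x) K = restrict (\<lambda>x. (a x * b x + (d * a x + c * b x)) + c * d) K"
  proof (rule restrict_ext)
    fix x assume "x \<in> K"
    then show "f x * g x = (a x * b x + (d * a x + c * b x)) + c * d"
      using fun_cong[OF a(2), of x] fun_cong[OF b(2), of x] by (simp add: algebra_simps)
  qed
  moreover have "restrict (\<lambda>x. a x * b x + (d * a x + c * b x)) K \<in> algebra_generated K G"
    using a(1) b(1)
    by (intro algebra_generated_add algebra_generated_mult algebra_generated_scale)
  ultimately show ?case
    by (intro exI[of _ "\<lambda>x. a x * b x + (d * a x + c * b x)"] exI[of _ "c * d"] conjI)
qed

lemma algebra_generated_subset_mspace_CK:
  assumes "compact K" "\<And>g. g \<in> G \<Longrightarrow> continuous_on K g"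
  shows "algebra_generated K G \<subseteq> mspace (CK K)"
proof
  fix f assume "f \<in> algebra_generated K G"
  then show "f \<in> mspace (CK K)"
    by (induction rule: algebra_generated_induct)
       (auto simp: restrict_mem_mspace_CK[OF assms(1)] assms(2) simp del: restrict_apply
             intro!: continuous_intros)
qed

text \<open>Every product has at least one factor, so a common zero of the generators is
  inherited.\<close>

lemma algebra_generated_vanishing:
  assumes "f \<in> algebra_generated K G" "x \<in> K" "\<And>g. g \<in> G \<Longrightarrow> g x = 0"
  shows "f x = 0"
  using assms(1) by (induction rule: algebra_generated_induct) (use assms(2,3) in auto)

section \<open>Conjugation and separation by the principle eigenfunctions\<close>

text \<open>Conjugation permutes the eigenbasis by an involution \<open>\<sigma>\<close>, and
  \<open>j = \<sigma> k\<close> works: both sides are complex linear in \<open>z\<close>, the right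
  one because it conjugates twice, and they agree on the basis.\<close>

lemma principle_eigenfunctions_conj:
  assumes "conj_eigenbasis M n e" "principle_eigenfunctions n e \<phi>" "k \<in> {1..n}"
  shows "\<exists>j\<in>{1..n}. \<forall>z. \<phi> j z = cnj (\<phi> k (cconj z))"
proof -
  have lin: "Vector_Spaces.linear cscale (*) (\<phi> i)" if "i \<in> {1..n}" for i
    using assms(2) that by (auto simp: principle_eigenfunctions_def)
  have dual: "\<phi> i (e j) = (if j = i then 1 else 0)" if "i \<in> {1..n}" "j \<in> {1..n}" for i j
    using assms(2) that by (auto simp: principle_eigenfunctions_def)
  have cc: "cconj (cconj z) = z" for z :: "'a \<times> 'a"
    by (simp add: cconj_def)
  have "\<exists>i\<in>{1..n}. e i = cconj (e j)" if j: "j \<in> {1..n}" for j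
  proof -
    have "e j \<in> range embed \<or> (j < n \<and> e (j + 1) = cconj (e j)) \<or> (1 < j \<and> e j = cconj (e (j - 1)))"
      using assms(1) j unfolding conj_eigenbasis_def by blast
    then consider "e j \<in> range embed" | "j < n" "e (j + 1) = cconj (e j)"
      | "1 < j" "e j = cconj (e (j - 1))" by blast
    then show ?thesis
    proof cases
      case 1
      then show ?thesis using j by (auto simp: embed_def cconj_def intro!: bexI[of _ j])
    next
      case 2
      then show ?thesis using j by (intro bexI[of _ "j + 1"]) auto
    next
      case 3
      then show ?thesis using j by (intro bexI[of _ "j - 1"]) (auto simp: cc)
    qed
  qed
  then obtain \<sigma> where \<sigma>: "\<And>j. j \<in> {1..n} \<Longrightarrow> \<sigma> j \<in> {1..n}"
      "\<And>j. j \<in> {1..n} \<Longrightarrow> e (\<sigma> j) = cconj (e j)"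
    by metis
  have inj: "inj_on e {1..n}" and span: "cplx.span (e ` {1..n}) = UNIV"
    using assms(1) by (auto simp: conj_eigenbasis_def)
  \<comment> \<open>Conjugating twice returns \<open>e j\<close>, and \<open>e\<close> is injective
    on the indices.\<close>
  have \<sigma>\<sigma>: "\<sigma> (\<sigma> j) = j" if "j \<in> {1..n}" for j
    using inj_onD[OF inj, of "\<sigma> (\<sigma> j)" j] \<sigma> that by (simp add: cc)
  interpret k: Vector_Spaces.linear cscale "(*)" "\<phi> k" using lin assms(3) .
  interpret j: Vector_Spaces.linear cscale "(*)" "\<phi> (\<sigma> k)" using lin \<sigma>(1)[OF assms(3)] .
  have "\<phi> (\<sigma> k) z = cnj (\<phi> k (cconj z))" for z
  proof -
    have "z \<in> cplx.span (e ` {1..n})" using span by simp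
    then show ?thesis
    proof (induction rule: cplx.span_induct_alt)
      case base
      have "cconj 0 = (0 :: 'a \<times> 'a)" by (simp add: cconj_def zero_prod_def)
      then show ?case by (simp add: k.zero j.zero)
    next
      case (step c v w)
      then obtain i where i: "i \<in> {1..n}" "v = e i" by blast
      have *: "cconj (cscale c v + w) = cscale (cnj c) (cconj v) + cconj w"
        by (simp add: cconj_def cscale_def)
      have "\<phi> (\<sigma> k) v = cnj (\<phi> k (cconj v))"
      proof -
        have "\<phi> k (cconj v) = (if \<sigma> i = k then 1 else 0)"
          using dual[OF assms(3) \<sigma>(1)[OF i(1)]] \<sigma>(2)[OF i(1)] i(2) by simp
        moreover have "\<phi> (\<sigma> k) v = (if i = \<sigma> k then 1 else 0)"
          using dual[OF \<sigma>(1)[OF assms(3)] i(1)] i(2) by simp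
        \<comment> \<open>This is where the involution enters: it matches the two Kronecker
          deltas.\<close>
        moreover have "\<sigma> i = k \<longleftrightarrow> i = \<sigma> k"
          using \<sigma>\<sigma> assms(3) i(1) by metis
        ultimately show ?thesis by simp
      qed
      with step show ?case
        unfolding * by (simp add: k.add j.add k.scale j.scale)
    qed
  qed
  with \<sigma>(1)[OF assms(3)] show ?thesis by blast
qed

text \<open>The value \<open>\<phi> k z\<close> is the coefficient of \<open>z\<close> at
  \<open>e k\<close>. Applied to a difference of points, this gives separation.\<close>

lemma principle_eigenfunctions_eq_0:
  assumes "conj_eigenbasis M n e" "principle_eigenfunctions n e \<phi>"
    and vanish: "\<And>k. k \<in> {1..n} \<Longrightarrow> \<phi> k z = 0"
  shows "z = 0"
proof -
  have inj: "inj_on e {1..n}" and "cplx.span (e ` {1..n}) = UNIV"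
    using assms(1) by (auto simp: conj_eigenbasis_def)
  then have "z \<in> range (\<lambda>u. \<Sum>v\<in>e ` {1..n}. cscale (u v) v)"
    using cplx.span_finite[of "e ` {1..n}"] by simp
  then obtain u where "z = (\<Sum>v\<in>e ` {1..n}. cscale (u v) v)"
    by blast
  then have z: "z = (\<Sum>j\<in>{1..n}. cscale (u (e j)) (e j))"
    by (simp only: sum.reindex[OF inj] o_def)
  have "u (e k) = 0" if "k \<in> {1..n}" for k
  proof -
    interpret Vector_Spaces.linear cscale "(*)" "\<phi> k"
      using assms(2) that by (auto simp: principle_eigenfunctions_def)
    have "\<phi> k z = (\<Sum>j\<in>{1..n}. u (e j) * \<phi> k (e j))"
      unfolding z by (simp add: sum scale)
    also have "\<dots> = (\<Sum>j\<in>{1..n}. if j = k then u (e j) else 0)"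
      using assms(2) that by (intro sum.cong) (auto simp: principle_eigenfunctions_def)
    also have "\<dots> = u (e k)"
      using that by simp
    finally show ?thesis using vanish[OF that] by simp
  qed
  then show ?thesis unfolding z by simp
qed

lemma linear_principle_eigenfunction_embed:
  assumes "principle_eigenfunctions n e \<phi>" "k \<in> {1..n}"
  shows "linear (\<lambda>x. \<phi> k (embed x))"
proof -
  interpret Vector_Spaces.linear cscale "(*)" "\<phi> k"
    using assms by (auto simp: principle_eigenfunctions_def)
  have "\<phi> k (embed (c *\<^sub>R x)) = c *\<^sub>R \<phi> k (embed x)" for c x
    using scale[of "complex_of_real c" "embed x"]
    by (simp add: embed_def cscale_def scaleR_conv_of_real)
  moreover have "\<phi> k (embed (x + y)) = \<phi> k (embed x) + \<phi> k (embed y)" for x y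
    using add[of "embed x" "embed y"] by (simp add: embed_def)
  ultimately show ?thesis by (intro linearI)
qed

section \<open>The ring of continuous functions and its ideal at the origin\<close>

lemma cring_CK_ring:
  assumes "compact K"
  shows "cring (CK_ring K)"
proof (rule cringI)
  note ms = mspace_CK[OF assms]
  show "abelian_group (CK_ring K)"
  proof (rule abelian_groupI)
    fix f assume f: "f \<in> carrier (CK_ring K)"
    then show "\<exists>g\<in>carrier (CK_ring K). g \<oplus>\<^bsub>CK_ring K\<^esub> f = \<zero>\<^bsub>CK_ring K\<^esub>"
      by (intro bexI[of _ "restrict (\<lambda>x. - f x) K"])
         (auto simp: CK_ring_def ms continuous_on_minus cong: continuous_on_cong)
  qed (auto simp: CK_ring_def ms continuous_on_add algebra_simps extensional_def fun_eq_iff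
         cong: continuous_on_cong)
  show "comm_monoid (CK_ring K)"
    by (rule comm_monoidI)
       (auto simp: CK_ring_def ms continuous_on_mult algebra_simps extensional_def fun_eq_iff
         cong: continuous_on_cong)
qed (auto simp: CK_ring_def algebra_simps)

text \<open>If a larger ideal contains \<open>f\<close> with \<open>f 0 \<noteq> 0\<close>, then
  \<open>1 = f / f 0 + (1 - f / f 0)\<close> lies in it: the first summand is a multiple of
  \<open>f\<close>, the second vanishes at \<open>0\<close>.\<close>

lemma maximalideal_ideal_at_zero:
  assumes "compact K" "0 \<in> K"
  shows "maximalideal (ideal_at_zero K) (CK_ring K)"
proof (rule maximalidealI)
  note ms = mspace_CK[OF assms(1)]
  interpret R: cring "CK_ring K" using cring_CK_ring[OF assms(1)] .
  \<comment> \<open>The subgroup condition speaks of the inverse in \<open>add_monoid\<close>, which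
    is identified here with pointwise negation.\<close>
  have minus: "restrict (\<lambda>x. - f x) K = inv\<^bsub>add_monoid (CK_ring K)\<^esub> f"
    if "f \<in> mspace (CK K)" for f
    using that unfolding a_inv_def[symmetric]
    by (intro R.minus_equality[symmetric])
       (auto simp: CK_ring_def ms continuous_on_minus cong: continuous_on_cong)
  show "ideal (ideal_at_zero K) (CK_ring K)"
  proof (rule idealI)
    show "ring (CK_ring K)" by unfold_locales
    show "subgroup (ideal_at_zero K) (add_monoid (CK_ring K))"
    proof
      fix f assume f: "f \<in> ideal_at_zero K"
      have "restrict (\<lambda>x. - f x) K \<in> ideal_at_zero K"
        using f assms(2) by (auto simp: ideal_at_zero_def ms continuous_on_minus cong: continuous_on_cong)
      then show "inv\<^bsub>add_monoid (CK_ring K)\<^esub> f \<in> ideal_at_zero K"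
        using f minus[of f] by (simp only: ideal_at_zero_def mem_Collect_eq)
    qed (use assms(2) in \<open>auto simp: ideal_at_zero_def CK_ring_def ms continuous_on_add cong: continuous_on_cong\<close>)
  qed (use assms(2) in \<open>auto simp: ideal_at_zero_def CK_ring_def ms continuous_on_mult cong: continuous_on_cong\<close>)
  have "restrict (\<lambda>x. 1) K \<in> carrier (CK_ring K)" "restrict (\<lambda>x. 1) K \<notin> ideal_at_zero K"
    using assms(2) by (auto simp: CK_ring_def ideal_at_zero_def ms cong: continuous_on_cong)
  then show "carrier (CK_ring K) \<noteq> ideal_at_zero K" by blast
  fix J assume J: "ideal J (CK_ring K)" "ideal_at_zero K \<subseteq> J" "J \<subseteq> carrier (CK_ring K)"
  interpret J: ideal J "CK_ring K" by fact
  show "J = ideal_at_zero K \<or> J = carrier (CK_ring K)"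
  proof (rule ccontr)
    assume *: "\<not> ?thesis"
    then obtain f where f: "f \<in> J" "f \<notin> ideal_at_zero K" using J(2) by blast
    with J(3) have fc: "f \<in> extensional K" "continuous_on K f" and f0: "f 0 \<noteq> 0"
      by (auto simp: ideal_at_zero_def CK_ring_def ms)
    let ?g = "restrict (\<lambda>x. f x / f 0) K" and ?h = "restrict (\<lambda>x. 1 - f x / f 0) K"
    have "restrict (\<lambda>x. 1 / f 0) K \<in> carrier (CK_ring K)"
      by (auto simp: CK_ring_def ms cong: continuous_on_cong)
    then have "f \<otimes>\<^bsub>CK_ring K\<^esub> restrict (\<lambda>x. 1 / f 0) K \<in> J"
      using J.I_r_closed[OF f(1)] by blast
    also have "f \<otimes>\<^bsub>CK_ring K\<^esub> restrict (\<lambda>x. 1 / f 0) K = ?g"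
      by (auto simp: CK_ring_def)
    finally have "?g \<in> J" .
    have "continuous_on K (\<lambda>x. 1 - f x / f 0)"
      by (intro continuous_intros fc) (use f0 in auto)
    then have "?h \<in> ideal_at_zero K"
      using f0 assms(2) by (auto simp: ideal_at_zero_def ms cong: continuous_on_cong)
    then have "?h \<in> J" using J(2) by blast
    then have "?g \<oplus>\<^bsub>CK_ring K\<^esub> ?h \<in> J"
      using J.a_closed \<open>?g \<in> J\<close> by blast
    also have "?g \<oplus>\<^bsub>CK_ring K\<^esub> ?h = \<one>\<^bsub>CK_ring K\<^esub>"
      by (auto simp: CK_ring_def)
    finally show False
      using J.one_imp_carrier * by blast
  qed
qed

section \<open>The two closures of the principle algebra\<close>

theorem proposition5p1:
  fixes T :: "'a::banach \<Rightarrow> 'a"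
    and K :: "'a set"
    and n :: nat
    and e :: "nat \<Rightarrow> 'a \<times> 'a"
    and \<phi> :: "nat \<Rightarrow> 'a \<times> 'a \<Rightarrow> complex"
  assumes "\<exists>B :: 'a set. finite B \<and> span B = UNIV"
    and "n = dim (UNIV :: 'a set)"
    and "polynomial_function T" and "diffeomorphism T"
    and "T 0 = 0" and "asymptotically_stable T 0" and "hyperbolic T 0"
    and "diagonalizable (complexify (frechet_derivative T (at 0)))"
    and "conj_eigenbasis (complexify (frechet_derivative T (at 0))) n e"
    and "principle_eigenfunctions n e \<phi>"
    and "compact K" and "0 \<in> interior K"
  shows "uniform_closure K (algebra_generated K (principle_algebra K n \<phi> \<union> constants K))
           = mspace (CK K) \<and>
         uniform_closure K (principle_algebra K n \<phi>) = ideal_at_zero K \<and>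
         maximalideal (ideal_at_zero K) (CK_ring K)"
proof -
  note basis = assms(9) and dual = assms(10) and K = \<open>compact K\<close>
  have "0 \<in> K" using assms(12) interior_subset by blast
  then have "K \<noteq> {}" by blast
  define \<psi> where "\<psi> k x = \<phi> k (embed x)" for k x
  define G where "G = (\<lambda>k. restrict (\<psi> k) K) ` {1..n}"
  define A where "A = algebra_generated K G"
  define A1 where "A1 = algebra_generated K (A \<union> constants K)"
  have A_eq: "principle_algebra K n \<phi> = A"
    by (simp add: A_def G_def \<psi>_def[abs_def] principle_algebra_def)
  have lin: "linear (\<psi> k)" if "k \<in> {1..n}" for k
    using linear_principle_eigenfunction_embed[OF dual that] by (simp add: \<psi>_def[abs_def])
  have cont: "continuous_on K (\<psi> k)" if "k \<in> {1..n}" for k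
    using assms(1) linear_continuous_on_finite_span lin[OF that] by blast
  have \<psi>_A: "restrict (\<psi> k) K \<in> A" if "k \<in> {1..n}" for k
    using restrict_generator_in_algebra[of "restrict (\<psi> k) K" G K] that by (simp add: A_def G_def)
  have A_CK: "A \<subseteq> mspace (CK K)"
    unfolding A_def
    by (rule algebra_generated_subset_mspace_CK[OF K]) (auto simp: G_def cont cong: continuous_on_cong)
  have A1_CK: "A1 \<subseteq> mspace (CK K)"
    unfolding A1_def
    by (rule algebra_generated_subset_mspace_CK[OF K])
       (use A_CK in \<open>auto simp: mspace_CK[OF K] constants_def cong: continuous_on_cong\<close>)
  have A_A1: "f \<in> A1" if "f \<in> A" for f
  proof -
    have "restrict f K = f" using A_CK that by (auto simp: mspace_CK[OF K] extensional_restrict)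
    then show ?thesis
      using restrict_generator_in_algebra[of f "A \<union> constants K" K] that by (simp add: A1_def)
  qed
  have A_0: "f 0 = 0" if "f \<in> A" for f
    using that unfolding A_def
    by (rule algebra_generated_vanishing) (use \<open>0 \<in> K\<close> in \<open>auto simp: G_def linear_0 lin\<close>)
  have sep: "\<exists>g. continuous_on K g \<and> g x \<noteq> g y \<and> restrict g K \<in> A1 \<and>
      restrict (\<lambda>x. cnj (g x)) K \<in> A1" if "x \<noteq> y" for x y
  proof -
    have "embed (x - y) \<noteq> 0" using that by (simp add: embed_def zero_prod_def)
    then obtain k where k: "k \<in> {1..n}" "\<psi> k (x - y) \<noteq> 0"
      using principle_eigenfunctions_eq_0[OF basis dual] unfolding \<psi>_def by blast
    obtain j where j: "j \<in> {1..n}" "\<And>z. \<phi> j z = cnj (\<phi> k (cconj z))"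
      using principle_eigenfunctions_conj[OF basis dual k(1)] by blast
    \<comment> \<open>Real points are fixed by \<open>cconj\<close>, so on them the conjugate of
      \<open>\<psi> k\<close> is itself a principle eigenfunction.\<close>
    have "\<psi> j = (\<lambda>x. cnj (\<psi> k x))"
      by (auto simp: \<psi>_def j(2) embed_def cconj_def)
    then have "restrict (\<lambda>x. cnj (\<psi> k x)) K \<in> A1"
      using A_A1[OF \<psi>_A[OF j(1)]] by simp
    moreover have "\<psi> k x \<noteq> \<psi> k y"
      using k(2) linear_diff[OF lin[OF k(1)], of x y] by auto
    ultimately show ?thesis
      using cont[OF k(1)] A_A1[OF \<psi>_A[OF k(1)]] by blast
  qed
  have dense: "\<exists>h\<in>A1. \<forall>x\<in>K. cmod (f x - h x) < r" if "f \<in> mspace (CK K)" "r > 0" for f r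
    unfolding A1_def
  proof (rule Stone_Weierstrass_algebra_generated[OF K constants_in_algebra _ _ \<open>r > 0\<close>])
    show "continuous_on K f" using that(1) by (simp add: mspace_CK[OF K])
  qed (use sep in \<open>simp add: A1_def\<close>)
  have "uniform_closure K A1 = mspace (CK K)"
    using dense by (auto simp: mem_uniform_closure_iff[OF K \<open>K \<noteq> {}\<close> A1_CK])
  moreover have "uniform_closure K A = ideal_at_zero K"
  proof (intro equalityI subsetI)
    fix f assume "f \<in> uniform_closure K A"
    then have f: "f \<in> mspace (CK K)" "\<And>r. r > 0 \<Longrightarrow> \<exists>g\<in>A. \<forall>x\<in>K. cmod (f x - g x) < r"
      by (auto simp: mem_uniform_closure_iff[OF K \<open>K \<noteq> {}\<close> A_CK])
    \<comment> \<open>Every approximant \<open>g\<close> from \<open>A\<close> vanishes at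
      \<open>0\<close>, so the error there is \<open>cmod (f 0)\<close> itself.\<close>
    have "cmod (f 0) < r" if "r > 0" for r
      using f(2)[OF that] A_0 \<open>0 \<in> K\<close> by fastforce
    then have "f 0 = 0" by (metis less_irrefl zero_less_norm_iff)
    with f(1) show "f \<in> ideal_at_zero K" by (simp add: ideal_at_zero_def)
  next
    fix f assume "f \<in> ideal_at_zero K"
    then have f: "f \<in> mspace (CK K)" "f 0 = 0" by (auto simp: ideal_at_zero_def)
    have "\<exists>g\<in>A. \<forall>x\<in>K. cmod (f x - g x) < r" if "r > 0" for r
    proof -
      obtain h where h: "h \<in> A1" "\<And>x. x \<in> K \<Longrightarrow> cmod (f x - h x) < r / 2"
        using dense[OF f(1), of "r / 2"] \<open>r > 0\<close> by auto
      obtain a c where a: "restrict a K \<in> A" "h = restrict (\<lambda>x. a x + c) K"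
        using algebra_generated_constants_decomp h(1) unfolding A1_def A_def by blast
      have "a 0 = 0" using A_0[OF a(1)] \<open>0 \<in> K\<close> by simp
      \<comment> \<open>At the origin \<open>f\<close> and \<open>a\<close> both vanish, so the
        error of \<open>h\<close> there is exactly \<open>cmod c\<close>.\<close>
      then have c: "cmod c < r / 2" using h(2)[OF \<open>0 \<in> K\<close>] f(2) \<open>0 \<in> K\<close> by (simp add: a(2))
      have "cmod (f x - a x) < r" if "x \<in> K" for x
      proof -
        have "cmod (f x - a x) \<le> cmod (f x - h x) + cmod c"
          using norm_triangle_ineq[of "f x - h x" c] that by (simp add: a(2))
        then show ?thesis using h(2)[OF that] c by linarith
      qed
      with a(1) show ?thesis by (intro bexI[of _ "restrict a K"]) auto
    qed
    with f(1) show "f \<in> uniform_closure K A"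
      by (simp add: mem_uniform_closure_iff[OF K \<open>K \<noteq> {}\<close> A_CK])
  qed
  ultimately show ?thesis
    using maximalideal_ideal_at_zero[OF K \<open>0 \<in> K\<close>] by (simp add: A_eq A1_def)
qed

end
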